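(* Let $\epsilon>0$ and let $Z=f(x,\Xi)$ with $x\in\mathcal{X}$. Assume that $\tau\in\mathbb{R}_+$ satisfies $\tau\le\frac12\epsilon^{-1}$. Then for any $\mu\in\mathbb{R}_+$, $$d_{\mu,\tau}:=\mathbb{E}\left[\psi_{ss}^{\mu,\tau}(Z)\right]-\epsilon^{-1}\,\mathbb{E}\left[[Z+\epsilon]_+-[Z]_+\right]\ge 0.$$
   Context: $(\Omega,\mathcal{F},\mathbb{P})$ is a probability space and $\Xi:\Omega\to\mathbb{R}^d$ is a random vector. $\mathcal{X}=\{x\in\mathbb{R}^n : g(x)\ge 0\}$ is nonempty and compact, with $g:\mathbb{R}^n\to\mathbb{R}^m$ twice differentiable. The scalar function $f(x,\xi)$, $x\in\mathbb{R}^n$, $\xi\in\mathbb{R}^d$, is real-valued and twice continuously differentiable. Write $[a]_+:=\max\{a,0\}$ and $$\psi_{ss}^{\mu,\tau}(z):=\left[2\,\frac{1+\mu}{\mu+e^{-\tau z}}-1\right]_+,\qquad z\in\mathbb{R}.$$ The parameter $\epsilon$ is that of the difference-of-convex (DC) approximation $\epsilon^{-1}\mathbb{E}[[f(x,\Xi)+\epsilon]_+-[f(x,\Xi)]_+]\le\alpha$ of the chance constraint $\mathbb{P}(f(x,\Xi)>0)\le\alpha$. Expectations of nonnegative random variables take values in $[0,\infty]$. *)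

theory Defs
  imports "HOL-Probability.Probability"
begin

definition twice_differentiable ::
  "('a::real_normed_vector \<Rightarrow> 'b::real_normed_vector) \<Rightarrow> bool" where
  "twice_differentiable h \<longleftrightarrow>
     (\<exists>h' :: 'a \<Rightarrow> 'a \<Rightarrow>\<^sub>L 'b.
        (\<forall>p. (h has_derivative blinfun_apply (h' p)) (at p)) \<and>
        (\<forall>p. h' differentiable (at p)))"

definition twice_continuously_differentiable ::
  "('a::real_normed_vector \<Rightarrow> 'b::real_normed_vector) \<Rightarrow> bool" where
  "twice_continuously_differentiable h \<longleftrightarrow>
     (\<exists>(h' :: 'a \<Rightarrow> 'a \<Rightarrow>\<^sub>L 'b) (h'' :: 'a \<Rightarrow> 'a \<Rightarrow>\<^sub>L ('a \<Rightarrow>\<^sub>L 'b)).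
        (\<forall>p. (h has_derivative blinfun_apply (h' p)) (at p)) \<and>
        (\<forall>p. (h' has_derivative blinfun_apply (h'' p)) (at p)) \<and>
        continuous_on UNIV h'')"

definition feasible_set :: "(real ^ 'n \<Rightarrow> real ^ 'm) \<Rightarrow> (real ^ 'n) set" where
  "feasible_set g = {x. \<forall>j. g x $ j \<ge> 0}"

definition pos_part :: "real \<Rightarrow> real" where
  "pos_part a = max a 0"

definition psi_ss :: "real \<Rightarrow> real \<Rightarrow> real \<Rightarrow> real" where
  "psi_ss \<mu> \<tau> z = pos_part (2 * ((1 + \<mu>) / (\<mu> + exp (- \<tau> * z))) - 1)"

(* Intended for nonnegative Y only (ennreal sends negative reals to 0). The value may be
   infinite; it is embedded into ereal so that differences can be formed. *)
definition expectation_ext :: "'w measure \<Rightarrow> ('w \<Rightarrow> real) \<Rightarrow> ereal" where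
  "expectation_ext M Y = enn2ereal (\<integral>\<^sup>+ \<omega>. ennreal (Y \<omega>) \<partial>M)"

(* For \<mu> = 0 the function psi_ss is unbounded and the minuend can be infinite. For
   \<epsilon> > 0 and M a probability space the subtrahend lies in [0, 1], so the difference is always well-defined. *)
definition d_gap :: "'w measure \<Rightarrow> ('w \<Rightarrow> real) \<Rightarrow> real \<Rightarrow> real \<Rightarrow> real \<Rightarrow> ereal" where
  "d_gap M Z \<epsilon> \<mu> \<tau> =
     expectation_ext M (\<lambda>\<omega>. psi_ss \<mu> \<tau> (Z \<omega>))
       - ereal (inverse \<epsilon>) *
         expectation_ext M (\<lambda>\<omega>. pos_part (Z \<omega> + \<epsilon>) - pos_part (Z \<omega>))"

end

theory Submission
  imports Defs
begin

text \<open>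
  The inequality already holds pointwise. Dividing \<open>[z + \<epsilon>]\<^sub>+ - [z]\<^sub>+\<close> by \<open>\<epsilon>\<close> gives the ramp that is \<open>0\<close>
  up to \<open>-\<epsilon>\<close>, equals \<open>1 + z / \<epsilon>\<close> on \<open>[-\<epsilon>, 0]\<close>, and stays \<open>1\<close> afterwards. The function \<open>psi_ss\<close>
  dominates it on each piece: being a positive part it is nonnegative everywhere, and it is at
  least \<open>1\<close> for \<open>z \<ge> 0\<close>. On the sloped piece the worst case is \<open>\<mu> = 0\<close>, where \<open>psi_ss\<close> is the positive
  part of \<open>2 exp (\<tau> z) - 1\<close>; the tangent of the exponential bounds this from below by \<open>1 + 2 \<tau> z\<close>, and
  \<open>2 \<tau> \<le> 1 / \<epsilon>\<close> makes that line no steeper than the ramp, hence not below it for negative \<open>z\<close>.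

  The pointwise bound \<open>ramp_le_psi_ss\<close> passes to the extended expectations by monotonicity
  (\<open>expectation_ext_cmult_mono\<close>). Measurability of \<open>Z\<close>, which is needed to move \<open>1 / \<epsilon>\<close> under the
  integral, comes from the continuity of \<open>f x\<close>.
\<close>

lemma psi_ss_nonneg: "psi_ss \<mu> \<tau> z \<ge> 0"
  by (simp add: psi_ss_def pos_part_def)

lemma psi_ss_ge_one:
  assumes "\<tau> \<ge> 0" "\<mu> \<ge> 0" "z \<ge> 0"
  shows "psi_ss \<mu> \<tau> z \<ge> 1"
proof -
  have "exp (- \<tau> * z) \<le> 1"
    using assms by simp
  moreover have "\<mu> + exp (- \<tau> * z) > 0"
    using assms by (simp add: add_nonneg_pos)
  ultimately have "(1 + \<mu>) / (\<mu> + exp (- \<tau> * z)) \<ge> 1"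
    by (simp add: le_divide_eq)
  then show ?thesis
    unfolding psi_ss_def pos_part_def by linarith
qed

text \<open>
  With \<open>s = - z / \<epsilon>\<close> and \<open>t = - \<tau> z \<le> s / 2\<close>, clearing the denominator turns the claim into
  \<open>(2 - s) exp t \<le> 2 + s \<mu>\<close>. This follows from \<open>2 - s \<le> 2 (1 - t) \<le> 2 exp (- t)\<close>, since \<open>s \<mu> \<ge> 0\<close>.
\<close>

lemma psi_ss_ge_line:
  assumes "\<epsilon> > 0" "\<tau> \<le> 1 / 2 * inverse \<epsilon>" "\<mu> \<ge> 0" "z \<le> 0"
  shows "psi_ss \<mu> \<tau> z \<ge> 1 + z / \<epsilon>"
proof -
  define s where "s = - z / \<epsilon>"
  define t where "t = - \<tau> * z"
  have s: "s \<ge> 0"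
    using assms(1,4) by (simp add: s_def divide_nonpos_pos)
  have "\<tau> * (- z) \<le> (1 / 2 * inverse \<epsilon>) * (- z)"
    using assms(4) by (intro mult_right_mono[OF assms(2)]) simp
  also have "\<dots> = s / 2"
    unfolding s_def divide_inverse by algebra
  finally have ts: "t \<le> s / 2"
    unfolding t_def by linarith
  have "2 - s \<le> 2 * exp (- t)"
    using ts exp_ge_add_one_self[of "- t"] by linarith
  then have "(2 - s) * exp t \<le> 2 * exp (- t) * exp t"
    by (intro mult_right_mono) auto
  also have "\<dots> = 2"
    by (simp add: exp_minus)
  finally have "(2 - s) * exp t \<le> 2" .
  then have "(2 - s) * (\<mu> + exp t) \<le> 2 * (1 + \<mu>)"
    using mult_nonneg_nonneg[OF s \<open>\<mu> \<ge> 0\<close>] by (simp add: algebra_simps)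
  moreover have "\<mu> + exp t > 0"
    using assms(3) by (simp add: add_nonneg_pos)
  ultimately have "2 - s \<le> 2 * ((1 + \<mu>) / (\<mu> + exp t))"
    by (simp add: le_divide_eq)
  then show ?thesis
    unfolding psi_ss_def pos_part_def s_def t_def minus_divide_left[symmetric] by linarith
qed

lemma ramp_le_psi_ss:
  assumes "\<epsilon> > 0" "\<tau> \<ge> 0" "\<tau> \<le> 1 / 2 * inverse \<epsilon>" "\<mu> \<ge> 0"
  shows "inverse \<epsilon> * (pos_part (z + \<epsilon>) - pos_part z) \<le> psi_ss \<mu> \<tau> z"
proof -
  consider "z \<ge> 0" | "- \<epsilon> \<le> z" "z \<le> 0" | "z \<le> - \<epsilon>"
    by linarith
  then show ?thesis
  proof cases
    case 1
    then show ?thesis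
      using psi_ss_ge_one[OF assms(2,4) 1] assms(1) by (simp add: pos_part_def)
  next
    case 2
    then have "inverse \<epsilon> * (pos_part (z + \<epsilon>) - pos_part z) = 1 + z / \<epsilon>"
      using assms(1) by (simp add: pos_part_def field_simps)
    then show ?thesis
      using psi_ss_ge_line[OF assms(1,3,4) 2(2)] by simp
  next
    case 3
    then show ?thesis
      using psi_ss_nonneg[of \<mu> \<tau> z] assms(1) by (simp add: pos_part_def)
  qed
qed

lemma expectation_ext_cmult_mono:
  assumes "c \<ge> 0" "Y \<in> borel_measurable M" "\<And>\<omega>. c * Y \<omega> \<le> W \<omega>"
  shows "ereal c * expectation_ext M Y \<le> expectation_ext M W"
proof -
  have "ereal c * expectation_ext M Y = enn2ereal (ennreal c * (\<integral>\<^sup>+ \<omega>. ennreal (Y \<omega>) \<partial>M))"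
    using assms by (simp add: expectation_ext_def times_ennreal.rep_eq enn2ereal_ennreal)
  also have "\<dots> = enn2ereal (\<integral>\<^sup>+ \<omega>. ennreal (c * Y \<omega>) \<partial>M)"
    using assms by (simp add: ennreal_mult' nn_integral_cmult)
  also have "\<dots> \<le> expectation_ext M W"
    using assms unfolding expectation_ext_def less_eq_ennreal.rep_eq[symmetric]
    by (intro nn_integral_mono ennreal_leI) auto
  finally show ?thesis .
qed

lemma twice_continuously_differentiable_imp_continuous:
  assumes "twice_continuously_differentiable h"
  shows "continuous_on S h"
proof -
  obtain h' where h': "\<And>p. (h has_derivative blinfun_apply (h' p)) (at p)"
    using assms unfolding twice_continuously_differentiable_def by auto
  show ?thesis
    by (intro continuous_at_imp_continuous_on ballI has_derivative_continuous[OF h'])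
qed

theorem proposition2:
  fixes M :: "'w measure"
    and \<Xi> :: "'w \<Rightarrow> real ^ 'd"
    and g :: "real ^ 'n \<Rightarrow> real ^ 'm"
    and f :: "real ^ 'n \<Rightarrow> real ^ 'd \<Rightarrow> real"
    and x :: "real ^ 'n"
    and Z :: "'w \<Rightarrow> real"
    and \<epsilon> \<mu> \<tau> :: real
  assumes "prob_space M"
    and "\<Xi> \<in> borel_measurable M"
    and "twice_differentiable g"
    and "feasible_set g \<noteq> {}"
    and "compact (feasible_set g)"
    and "twice_continuously_differentiable (\<lambda>(y, \<xi>). f y \<xi>)"
    and "\<epsilon> > 0"
    and "x \<in> feasible_set g"
    and "Z = (\<lambda>\<omega>. f x (\<Xi> \<omega>))"
    and "\<tau> \<ge> 0"
    and "\<tau> \<le> 1 / 2 * inverse \<epsilon>"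
    and "\<mu> \<ge> 0"
  shows "d_gap M Z \<epsilon> \<mu> \<tau> \<ge> 0"
proof -
  have "continuous_on UNIV ((\<lambda>(y, \<xi>). f y \<xi>) \<circ> Pair x)"
  proof (rule continuous_on_compose)
    show "continuous_on UNIV (Pair x :: real ^ 'd \<Rightarrow> _)"
      by (intro continuous_intros)
    show "continuous_on (range (Pair x)) (\<lambda>(y, \<xi>). f y \<xi>)"
      by (rule twice_continuously_differentiable_imp_continuous[OF assms(6)])
  qed
  then have "f x \<in> borel_measurable borel"
    by (intro borel_measurable_continuous_onI) (simp add: comp_def)
  then have Z [measurable]: "Z \<in> borel_measurable M"
    unfolding assms(9) by (rule measurable_compose[OF assms(2)])
  have "(\<lambda>\<omega>. pos_part (Z \<omega> + \<epsilon>) - pos_part (Z \<omega>)) \<in> borel_measurable M"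
    unfolding pos_part_def by measurable
  then have "ereal (inverse \<epsilon>) * expectation_ext M (\<lambda>\<omega>. pos_part (Z \<omega> + \<epsilon>) - pos_part (Z \<omega>))
      \<le> expectation_ext M (\<lambda>\<omega>. psi_ss \<mu> \<tau> (Z \<omega>))"
    using assms(7) by (intro expectation_ext_cmult_mono ramp_le_psi_ss[OF assms(7,10,11,12)]) auto
  then show ?thesis
    unfolding d_gap_def by (rule ereal_diff_positive)
qed

end
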